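(* Let $b\ge2$, $N\ge1$, and let $A=(a_0,\ldots,a_{b-1})$ be a zero-sum vector. Then the polynomial equation \[ F_N(x;A)=P_N(x;C_N)\prod_{m=0}^{N-1}\bigl(1-x^{b^m}\bigr) \] has a solution $P_N(x;C_N)=\sum_{n=0}^{b^N-1}c_nx^n$ whose coefficients are given, for $0\le n\le b^N-1$, by \[ c_n=\sum_{k\in I_b(n)}a_{u_b(k)},\qquad I_b(n)=\{k\in\mathbb{N}: k\preceq n\}. \] Moreover, $c_n=0$ for all $n$ whose base-$b$ expansion contains the digit $b-1$.
   Context: A zero-sum vector is a tuple $(a_0,\dots,a_{b-1})$ of complex numbers with $a_0+\cdots+a_{b-1}=0$. For a non-negative integer $n$ with base-$b$ digits $n_0,\dots,n_d$, $u_b(n)=\sum_j n_j \bmod b\in\{0,\dots,b-1\}$. $F_N(x;A)=\sum_{n=0}^{b^N-1}a_{u_b(n)}x^n$. Digital dominance: $k\preceq n$ means every base-$b$ digit of $k$ is at most the corresponding base-$b$ digit of $n$; $\mathbb{N}$ includes $0$. *)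

theory Defs
  imports "HOL-Library.Log_Nat" "HOL-Computational_Algebra.Polynomial" Complex_Main
begin

text \<open>Digits are indexed from the least significant one; positions beyond the leading digit
  of \<^term>\<open>n\<close> carry the digit 0.\<close>

definition digit :: "nat \<Rightarrow> nat \<Rightarrow> nat \<Rightarrow> nat" where
  "digit b n j = n div b ^ j mod b"

text \<open>For \<open>b \<ge> 2\<close>, \<^term>\<open>floorlog b n\<close> is the number of digits of \<^term>\<open>n\<close> in base \<^term>\<open>b\<close>,
  so the expansion is \<open>n\<^sub>0, \<dots>, n\<^sub>d\<close> with \<open>d + 1 = floorlog b n\<close>.  The expansion of 0 is
  empty in this convention, which affects neither the digit sum nor the occurrence of the
  (nonzero) digit \<open>b - 1\<close>.\<close>

definition digit_sum_mod :: "nat \<Rightarrow> nat \<Rightarrow> nat" where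
  "digit_sum_mod b n = (\<Sum>j<floorlog b n. digit b n j) mod b"

definition has_digit :: "nat \<Rightarrow> nat \<Rightarrow> nat \<Rightarrow> bool" where
  "has_digit b n e \<longleftrightarrow> (\<exists>j<floorlog b n. digit b n j = e)"

definition digit_dominated :: "nat \<Rightarrow> nat \<Rightarrow> nat \<Rightarrow> bool" where
  "digit_dominated b k n \<longleftrightarrow> (\<forall>j. digit b k j \<le> digit b n j)"

definition dominated_set :: "nat \<Rightarrow> nat \<Rightarrow> nat set" where
  "dominated_set b n = {k. digit_dominated b k n}"

text \<open>A tuple \<open>(a\<^sub>0, \<dots>, a\<^sub>b\<^sub>-\<^sub>1)\<close> is represented by a function on the naturals, of which only the
  values at indices below \<^term>\<open>b\<close> matter.\<close>

definition zero_sum :: "nat \<Rightarrow> (nat \<Rightarrow> complex) \<Rightarrow> bool" where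
  "zero_sum b a \<longleftrightarrow> (\<Sum>i<b. a i) = 0"

definition F_poly :: "nat \<Rightarrow> nat \<Rightarrow> (nat \<Rightarrow> complex) \<Rightarrow> complex poly" where
  "F_poly b N a = (\<Sum>n<b ^ N. monom (a (digit_sum_mod b n)) n)"

definition P_poly :: "nat \<Rightarrow> nat \<Rightarrow> (nat \<Rightarrow> complex) \<Rightarrow> complex poly" where
  "P_poly b N c = (\<Sum>n<b ^ N. monom (c n) n)"

end

theory Submission
  imports Defs
begin

text \<open>Let \<open>S\<close> be the base-\<open>b\<close> digit sum and extend \<open>a\<close> to a \<open>b\<close>-periodic function \<open>g\<close>. For each
  shift \<open>s\<close> put \<open>c\<^sub>s(n) = \<Sum>k\<preceq>n. g (S k + s)\<close>. Splitting off the lowest digit gives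
  \<open>c\<^sub>s(bq + r) = \<Sum>i\<le>r. c\<^bsub>s+i\<^esub>(q)\<close>, and \<open>\<Sum>i<b. c\<^bsub>s+i\<^esub>(q) = 0\<close> because \<open>g\<close> sums to zero over a
  period; hence \<open>c\<^sub>s\<close> vanishes when the digit \<open>b - 1\<close> occurs. Consequently, multiplying the
  generating function of \<open>c\<^sub>s\<close> by \<open>1 - x\<close> telescopes in the lowest digit without boundary term,
  and the product formula follows by induction on \<open>N\<close>, for all shifts simultaneously, with
  \<open>x\<close> replaced by \<open>x\<^sup>b\<close> in the induction hypothesis.\<close>

text \<open>The sum stays unreduced, so that splitting off a digit is an equation of naturals;
  reduction modulo \<open>b\<close> is left to the periodic weight \<open>g\<close>.\<close>

definition digit_sum :: "nat \<Rightarrow> nat \<Rightarrow> nat" where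
  "digit_sum b n = (\<Sum>j<floorlog b n. digit b n j)"

definition dom_sum :: "nat \<Rightarrow> (nat \<Rightarrow> 'a::comm_monoid_add) \<Rightarrow> nat \<Rightarrow> nat \<Rightarrow> 'a" where
  "dom_sum b g s n = (\<Sum>k\<in>dominated_set b n. g (digit_sum b k + s))"

lemma digit_0: "digit b n 0 = n mod b"
  by (simp add: digit_def)

lemma digit_Suc: "digit b n (Suc j) = digit b (n div b) j"
  by (simp add: digit_def div_mult2_eq)

lemma floorlog_div:
  assumes "b \<ge> 2" "n > 0"
  shows "floorlog b n = Suc (floorlog b (n div b))"
  using assms compute_floorlog[of b n] by simp

lemma digit_sum_0: "digit_sum b 0 = 0"
  by (simp add: digit_sum_def floorlog_def)

lemma digit_sum_rec:
  assumes "b \<ge> 2"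
  shows "digit_sum b n = n mod b + digit_sum b (n div b)"
proof (cases "n = 0")
  case False
  then show ?thesis
    using assms
    by (simp add: digit_sum_def floorlog_div sum.lessThan_Suc_shift digit_0 digit_Suc del: sum.lessThan_Suc)
qed (simp add: digit_sum_0)

lemma digit_sum_mult_add:
  assumes "b \<ge> 2" "r < b"
  shows "digit_sum b (b * q + r) = r + digit_sum b q"
  using assms digit_sum_rec[of b "b * q + r"] by simp

lemma has_digit_rec:
  assumes "b \<ge> 2"
  shows "has_digit b n e \<longleftrightarrow> n > 0 \<and> (n mod b = e \<or> has_digit b (n div b) e)"
proof (cases "n = 0")
  case True
  then show ?thesis by (simp add: has_digit_def floorlog_def)
next
  case False
  have "(\<exists>j<Suc m. P j) \<longleftrightarrow> P 0 \<or> (\<exists>j<m. P (Suc j))" for m and P :: "nat \<Rightarrow> bool"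
    by (metis less_Suc_eq_0_disj)
  with False assms show ?thesis
    by (simp add: has_digit_def floorlog_div digit_0 digit_Suc)
qed

lemma digit_dominated_rec:
  "digit_dominated b k n \<longleftrightarrow> k mod b \<le> n mod b \<and> digit_dominated b (k div b) (n div b)"
proof -
  have "(\<forall>j. P j) \<longleftrightarrow> P 0 \<and> (\<forall>j. P (Suc j))" for P :: "nat \<Rightarrow> bool"
    by (metis nat.exhaust)
  from this[of "\<lambda>j. digit b k j \<le> digit b n j"] show ?thesis
    by (simp add: digit_dominated_def digit_0 digit_Suc)
qed

lemma digit_dominated_le:
  assumes "b \<ge> 2" "digit_dominated b k n"
  shows "k \<le> n"
  using assms(2)
proof (induction k arbitrary: n rule: less_induct)
  case (less k)
  show ?case
  proof (cases "k = 0")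
    case False
    have "k mod b \<le> n mod b" "digit_dominated b (k div b) (n div b)"
      using less.prems digit_dominated_rec by blast+
    moreover from this have "k div b \<le> n div b"
      using less.IH[of "k div b"] False assms(1) by simp
    ultimately show ?thesis
      by (metis add_mono mult_div_mod_eq mult_le_mono2)
  qed simp
qed

lemma dominated_set_0:
  assumes "b \<ge> 2"
  shows "dominated_set b 0 = {0}"
  using digit_dominated_le[OF assms, of _ 0]
  by (auto simp: dominated_set_def digit_dominated_def)

text \<open>Dominance is checked digit by digit, so taking remainder and quotient by
  \<open>b\<close> maps the dominated set bijectively onto a product.\<close>

lemma sum_dominated_set_mult_add:
  assumes "b \<ge> 2" "r < b"
  shows "(\<Sum>k\<in>dominated_set b (b * q + r). f k)
       = (\<Sum>i\<le>r. \<Sum>k\<in>dominated_set b q. f (b * k + i))"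
proof -
  have mem: "k \<in> dominated_set b (b * q + r) \<longleftrightarrow> k mod b \<le> r \<and> k div b \<in> dominated_set b q" for k
    using digit_dominated_rec[of b k "b * q + r"] assms by (simp add: dominated_set_def)
  have "(\<Sum>k\<in>dominated_set b (b * q + r). f k)
      = (\<Sum>(i, k)\<in>{..r} \<times> dominated_set b q. f (b * k + i))"
    by (rule sum.reindex_bij_witness[where i = "\<lambda>(i, k). b * k + i" and j = "\<lambda>k. (k mod b, k div b)"])
       (use assms in \<open>auto simp: mem\<close>)
  then show ?thesis by (simp add: sum.cartesian_product)
qed

lemma sum_lessThan_mult_digit:
  fixes b m :: nat
  shows "(\<Sum>n<b * m. f n) = (\<Sum>r<b. \<Sum>q<m. f (b * q + r))"
proof (cases "b = 0")
  case False
  have "(\<Sum>n<b * m. f n) = (\<Sum>(r, q)\<in>{..<b} \<times> {..<m}. f (b * q + r))"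
  proof (rule sum.reindex_bij_witness[where i = "\<lambda>(r, q). b * q + r" and j = "\<lambda>n. (n mod b, n div b)"])
    fix p assume "p \<in> {..<b} \<times> {..<m}"
    then obtain r q where p: "p = (r, q)" "r < b" "q < m" by auto
    then have "b * q + r < b * Suc q" "b * Suc q \<le> b * m"
      by (simp, intro mult_le_mono2) simp
    then show "(case p of (r, q) \<Rightarrow> b * q + r) \<in> {..<b * m}"
      unfolding p by simp
  qed (use False in \<open>auto simp: less_mult_imp_div_less mult.commute[of b m]\<close>)
  then show ?thesis by (simp add: sum.cartesian_product)
qed simp

lemma dom_sum_mult_add:
  assumes "b \<ge> 2" "r < b"
  shows "dom_sum b g s (b * q + r) = (\<Sum>i\<le>r. dom_sum b g (s + i) q)"
  unfolding dom_sum_def sum_dominated_set_mult_add[OF assms]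
proof (intro sum.cong refl)
  fix i k assume "i \<in> {..r}"
  then have "digit_sum b (b * k + i) = i + digit_sum b k"
    using digit_sum_mult_add[of b i k] assms by simp
  then show "g (digit_sum b (b * k + i) + s) = g (digit_sum b k + (s + i))"
    by (simp add: add_ac)
qed

lemma sum_mod_shift:
  fixes b :: nat
  assumes "b > 0"
  shows "(\<Sum>i<b. f ((t + i) mod b)) = (\<Sum>i<b. f i)"
proof (induction t)
  case (Suc t)
  obtain m where b: "b = Suc m" using assms gr0_implies_Suc by blast
  \<comment> \<open>Raising the shift by one moves the term \<open>f (t mod b)\<close> from the
    front of the sum to its end.\<close>
  have "(\<Sum>i<b. f ((Suc t + i) mod b)) = (\<Sum>i<m. f ((t + Suc i) mod b)) + f (t mod b)"
    using mod_add_self2[of t b] by (simp add: b)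
  also have "\<dots> = (\<Sum>i<b. f ((t + i) mod b))"
    unfolding b sum.lessThan_Suc_shift by (simp add: add.commute[of _ "f (t mod Suc m)"])
  finally show ?case using Suc.IH by simp
qed simp

text \<open>For each fixed dominated \<open>k\<close>, the arguments of \<open>a\<close> run through
  a full period as \<open>i\<close> varies.\<close>

lemma sum_dom_sum_shift:
  assumes "b > 0" "(\<Sum>i<b. a i) = 0"
  shows "(\<Sum>i<b. dom_sum b (\<lambda>i. a (i mod b)) (s + i) q) = 0"
  unfolding dom_sum_def
  by (subst sum.swap) (simp add: sum_mod_shift[OF assms(1)] assms(2) flip: add.assoc)

lemma dom_sum_has_digit_eq_0:
  assumes "b \<ge> 2" "(\<Sum>i<b. a i) = 0" "has_digit b n (b - 1)"
  shows "dom_sum b (\<lambda>i. a (i mod b)) s n = 0"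
  using assms(3)
proof (induction n arbitrary: s rule: less_induct)
  case (less n)
  let ?g = "\<lambda>i. a (i mod b)"
  have pos: "n > 0" and or: "n mod b = b - 1 \<or> has_digit b (n div b) (b - 1)"
    using less.prems has_digit_rec[OF assms(1)] by blast+
  have split: "dom_sum b ?g s n = (\<Sum>i\<le>n mod b. dom_sum b ?g (s + i) (n div b))"
    using dom_sum_mult_add[of b "n mod b" ?g s "n div b"] assms(1) by simp
  \<comment> \<open>A last digit \<open>b - 1\<close> makes the sum in \<open>split\<close> a full
    period; a higher one kills every summand, by induction for all shifts.\<close>
  from or show ?case
  proof
    assume "n mod b = b - 1"
    moreover have "{..b - 1} = {..<b}" using assms(1) by auto
    ultimately show ?thesis
      unfolding split using sum_dom_sum_shift[of b a s "n div b"] assms by simp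
  next
    assume "has_digit b (n div b) (b - 1)"
    then have "dom_sum b ?g t (n div b) = 0" for t
      using less.IH[of "n div b" t] pos assms(1) by simp
    then show ?thesis unfolding split by simp
  qed
qed

text \<open>Summation by parts: consecutive inner sums differ by a single \<open>Q r\<close>, and
  the boundary term carries the total of \<open>Q\<close>.\<close>

lemma sum_power_telescope:
  fixes x :: "'a::comm_ring_1"
  shows "(1 - x) * (\<Sum>r<m. x ^ r * (\<Sum>i\<le>r. Q i)) = (\<Sum>r<m. x ^ r * Q r) - x ^ m * (\<Sum>i<m. Q i)"
  proof (induction m)
  case (Suc m)
  have "(\<Sum>i\<le>m. Q i) = (\<Sum>i<m. Q i) + Q m"
    by (metis lessThan_Suc_atMost sum.lessThan_Suc)
  with Suc.IH show ?case
    by (simp add: distrib_left) (simp add: algebra_simps)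
qed simp

text \<open>Stated for ring elements \<open>x\<close> rather than polynomials, so that
  \<open>x ^ b\<close> can be substituted directly.\<close>

lemma sum_digit_sum_eq_dom_sum_prod:
  fixes x :: "'a::comm_ring_1"
  assumes b: "b \<ge> 2" and zero: "(\<Sum>i<b. a i) = 0"
  defines "g \<equiv> \<lambda>i. a (i mod b)"
  shows "(\<Sum>n<b ^ N. g (digit_sum b n + s) * x ^ n)
       = (\<Sum>n<b ^ N. dom_sum b g s n * x ^ n) * (\<Prod>m<N. 1 - x ^ b ^ m)"
proof (induction N arbitrary: s x)
  case 0
  then show ?case by (simp add: dom_sum_def dominated_set_0[OF b])
next
  case (Suc N)
  define Q where "Q i = (\<Sum>q<b ^ N. dom_sum b g (s + i) q * (x ^ b) ^ q)" for i
  have "(\<Sum>i<b. Q i) = (\<Sum>q<b ^ N. (\<Sum>i<b. dom_sum b g (s + i) q) * (x ^ b) ^ q)"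
    unfolding Q_def by (subst sum.swap) (simp add: sum_distrib_right)
  then have Q0: "(\<Sum>i<b. Q i) = 0"
    using sum_dom_sum_shift[of b a] b zero by (simp add: g_def)
  have P: "(\<Sum>n<b ^ Suc N. dom_sum b g s n * x ^ n) = (\<Sum>r<b. x ^ r * (\<Sum>i\<le>r. Q i))"
    unfolding power_Suc sum_lessThan_mult_digit
  proof (rule sum.cong[OF refl])
    fix r assume "r \<in> {..<b}"
    then have "(\<Sum>q<b ^ N. dom_sum b g s (b * q + r) * x ^ (b * q + r))
        = (\<Sum>q<b ^ N. \<Sum>i\<le>r. x ^ r * (dom_sum b g (s + i) q * (x ^ b) ^ q))"
      by (simp add: dom_sum_mult_add[OF b] power_add power_mult sum_distrib_left sum_distrib_right)
         (simp only: mult_ac)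
    also have "\<dots> = x ^ r * (\<Sum>i\<le>r. Q i)"
      unfolding Q_def by (subst sum.swap) (simp add: sum_distrib_left)
    finally show "(\<Sum>q<b ^ N. dom_sum b g s (b * q + r) * x ^ (b * q + r)) = x ^ r * (\<Sum>i\<le>r. Q i)" .
  qed
  have "(\<Sum>n<b ^ Suc N. g (digit_sum b n + s) * x ^ n)
      = (\<Sum>r<b. x ^ r * (\<Sum>q<b ^ N. g (digit_sum b q + (s + r)) * (x ^ b) ^ q))"
    unfolding power_Suc sum_lessThan_mult_digit
    by (simp add: digit_sum_mult_add[OF b] power_add power_mult sum_distrib_left) (simp only: mult_ac add_ac)
  \<comment> \<open>The product in the induction hypothesis does not depend on the shift
    \<open>s + r\<close>, so it factors out of the sum over \<open>r\<close>.\<close>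
  also have "\<dots> = (\<Sum>r<b. x ^ r * Q r) * (\<Prod>m<N. 1 - (x ^ b) ^ b ^ m)"
    by (simp only: Suc.IH sum_distrib_right[where A = "{..<b}"] Q_def mult.assoc)
  also have "\<dots> = (\<Sum>n<b ^ Suc N. dom_sum b g s n * x ^ n) * ((1 - x) * (\<Prod>m<N. 1 - (x ^ b) ^ b ^ m))"
    unfolding P sum_power_telescope mult.assoc[symmetric] mult.commute[of _ "1 - x"]
    by (simp only: Q0) simp
  \<comment> \<open>The factor \<open>1 - x\<close> is the one for \<open>m = 0\<close>; the others
    move up by one index.\<close>
  also have "(1 - x) * (\<Prod>m<N. 1 - (x ^ b) ^ b ^ m) = (\<Prod>m<Suc N. 1 - x ^ b ^ m)"
    unfolding prod.lessThan_Suc_shift by (simp add: power_mult)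
  finally show ?case .
qed

theorem theorem3p6:
  fixes b N :: nat and a :: "nat \<Rightarrow> complex"
  assumes "b \<ge> 2" and "N \<ge> 1" and "zero_sum b a"
  shows "\<exists>c :: nat \<Rightarrow> complex.
      F_poly b N a = P_poly b N c * (\<Prod>m<N. 1 - monom 1 (b ^ m)) \<and>
      (\<forall>n<b ^ N. c n = (\<Sum>k\<in>dominated_set b n. a (digit_sum_mod b k))) \<and>
      (\<forall>n<b ^ N. has_digit b n (b - 1) \<longrightarrow> c n = 0)"
proof (intro exI conjI allI impI)
  let ?c = "dom_sum b (\<lambda>i. a (i mod b)) 0"
  have zero: "(\<Sum>i<b. a i) = 0" using assms(3) by (simp add: zero_sum_def)
  have u: "digit_sum_mod b n = digit_sum b n mod b" for n
    by (simp add: digit_sum_mod_def digit_sum_def)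
  show "F_poly b N a = P_poly b N ?c * (\<Prod>m<N. 1 - monom 1 (b ^ m))"
    \<comment> \<open>Complex polynomials are determined by their values, so evaluation at every
      point suffices.\<close>
    unfolding poly_eq_poly_eq_iff[symmetric]
    using sum_digit_sum_eq_dom_sum_prod[OF assms(1) zero, where N = N and s = 0]
    by (simp add: fun_eq_iff F_poly_def P_poly_def poly_sum poly_prod poly_monom u)
  show "?c n = (\<Sum>k\<in>dominated_set b n. a (digit_sum_mod b k))" for n
    by (simp add: dom_sum_def u)
  show "?c n = 0" if "has_digit b n (b - 1)" for n
    using dom_sum_has_digit_eq_0[OF assms(1) zero that] .
qed

end
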